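(* For every integer $n\ge 1$, $$(-1)^{n+1}(2(n+1))!\;2^{-2n-1}\zeta(2n+1)+(n+1)M_{2n+1}=\sum_{m=0}^{n}\binom{2(n+1)}{2(m+1)}B_{2(n-m)}\,\pi^{2(n-m)-1}M_{2(m+1)},$$ where $\zeta$ is the Riemann zeta function.
   Context: For integers $m\ge 2$, $M_m=\int_0^{\pi/2}\frac{t^m}{\sin^2 t}\,dt$. The Bernoulli numbers $B_m$ are defined by $\frac{x}{e^x-1}=\sum_{m=0}^\infty B_m\frac{x^m}{m!}$ for $|x|<2\pi$. *)

theory Defs
  imports "HOL-Complex_Analysis.Complex_Analysis"
begin

(* Only meaningful for m \<ge> 2. The junk value 0 of the integrand at t = 0 (division by zero)
   does not affect the integral. *)
definition M :: "nat \<Rightarrow> real" where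
  "M m = integral {0..pi/2} (\<lambda>t. t ^ m / (sin t)\<^sup>2)"

(* The point x = 0 is left out because x / (exp x - 1) has a removable singularity there. *)
definition is_bernoulli_seq :: "(nat \<Rightarrow> real) \<Rightarrow> bool" where
  "is_bernoulli_seq B \<longleftrightarrow>
     (\<forall>x::real. x \<noteq> 0 \<and> \<bar>x\<bar> < 2 * pi \<longrightarrow>
        (\<lambda>m. B m * (x ^ m / fact m)) sums (x / (exp x - 1)))"

definition bernoulli :: "nat \<Rightarrow> real" where
  "bernoulli = (THE B. is_bernoulli_seq B)"

(* The Dirichlet series, i.e. the Riemann zeta function on the half-line s > 1 only. *)
definition zeta :: "real \<Rightarrow> real" where
  "zeta s = (\<Sum>k. 1 / real (Suc k) powr s)"

lemma is_bernoulli_seq_exists: "\<exists>B. is_bernoulli_seq B"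
proof -
  define h :: "complex \<Rightarrow> complex" where "h = (\<lambda>z. if z = 0 then 1 else (exp z - 1) / z)"
  have h: "h holomorphic_on UNIV"
  proof -
    have deriv: "deriv (\<lambda>z::complex. exp z - 1) 0 = 1"
      by (rule DERIV_imp_deriv) (auto intro!: derivative_eq_intros)
    show ?thesis
    proof (rule pole_theorem_open_0[where g = "\<lambda>z. exp z - 1" and a = 0])
      show "(\<lambda>z::complex. exp z - 1) holomorphic_on UNIV"
        by (intro holomorphic_intros)
      show "exp z - 1 = (z - 0) * h z" if "z \<in> UNIV - {0}" for z
        using that by (simp add: h_def)
      show "h 0 = deriv (\<lambda>z::complex. exp z - 1) 0"
        unfolding deriv by (simp add: h_def)
    qed simp_all
  qed
  have nz: "h z \<noteq> 0" if "z \<in> ball 0 (2 * pi)" for z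
  proof
    assume "h z = 0"
    then have z: "z \<noteq> 0" "exp z = 1" by (auto simp: h_def split: if_splits)
    then obtain n :: int where n: "Re z = 0" "Im z = of_int (2 * n) * pi"
      by (auto simp: exp_eq_1)
    with z have "n \<noteq> 0" by (auto simp: complex_eq_iff)
    then have "1 \<le> \<bar>real_of_int n\<bar>" by linarith
    then have "2 * pi \<le> \<bar>Im z\<bar>" by (simp add: n abs_mult)
    also have "\<dots> \<le> norm z" by (rule abs_Im_le_cmod)
    finally show False using that by simp
  qed
  define g where "g = (\<lambda>z. 1 / h z)"
  have g: "g holomorphic_on ball 0 (2 * pi)"
    unfolding g_def using nz by (intro holomorphic_intros holomorphic_on_subset[OF h]) auto
  define B where "B n = Re ((deriv ^^ n) g 0)" for n
  have "(\<lambda>m. B m * (x ^ m / fact m)) sums (x / (exp x - 1))"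
    if x: "x \<noteq> 0" "\<bar>x\<bar> < 2 * pi" for x :: real
  proof -
    have "(\<lambda>n. (deriv ^^ n) g 0 / fact n * (of_real x - 0) ^ n) sums g (of_real x)"
      by (rule holomorphic_power_series[OF g]) (use x in auto)
    then have "(\<lambda>n. Re ((deriv ^^ n) g 0 / fact n * (of_real x - 0) ^ n)) sums Re (g (of_real x))"
      by (rule sums_Re)
    moreover have "Re ((deriv ^^ n) g 0 / fact n * (of_real x - 0) ^ n)
        = B n * (x ^ n / fact n)" for n
    proof -
      have "(deriv ^^ n) g 0 / fact n * (of_real x - 0) ^ n
          = of_real (x ^ n / fact n) * (deriv ^^ n) g 0"
        by simp
      then have "Re ((deriv ^^ n) g 0 / fact n * (of_real x - 0) ^ n)
          = Re (of_real (x ^ n / fact n) * (deriv ^^ n) g 0)"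
        by (rule arg_cong)
      also have "\<dots> = x ^ n / fact n * Re ((deriv ^^ n) g 0)"
        unfolding times_complex.sel Re_complex_of_real Im_complex_of_real by (simp only: mult_zero_left diff_zero)
      finally show ?thesis unfolding B_def by (simp only: mult.commute)
    qed
    moreover have "g (of_real x) = of_real (x / (exp x - 1))"
      using x by (simp add: g_def h_def exp_of_real)
    ultimately show ?thesis by (simp only: Re_complex_of_real)
  qed
  then show ?thesis unfolding is_bernoulli_seq_def by blast
qed

lemma is_bernoulli_seq_unique:
  assumes "is_bernoulli_seq B" "is_bernoulli_seq C"
  shows "B = C"
proof -
  define d where "d n = (B n - C n) / fact n" for n
  have d: "(\<lambda>n. d n * x ^ n) sums 0" if "x \<noteq> 0" "\<bar>x\<bar> < 2 * pi" for x
  proof -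
    have "(\<lambda>n. B n * (x ^ n / fact n) - C n * (x ^ n / fact n)) sums
            (x / (exp x - 1) - x / (exp x - 1))"
      using assms that by (intro sums_diff) (auto simp: is_bernoulli_seq_def)
    then show ?thesis by (simp add: d_def field_simps)
  qed
  have "((\<lambda>_. 0) \<longlongrightarrow> d 0) (at (0::real))"
    by (rule powser_limit_0_strong[where s = "2 * pi"]) (use d in auto)
  then have d0: "d 0 = 0" by (simp add: tendsto_const_iff)
  have d': "(\<lambda>n. d n * (x - 0) ^ n) sums 0" if "norm (x - 0) < 2 * pi" for x
  proof (cases "x = 0")
    case True
    then show ?thesis using powser_sums_zero[of d] d0 by simp
  qed (use d that in auto)
  have "d m = 0" for m
  proof (rule ccontr)
    assume m: "d m \<noteq> 0"
    with d0 have "m > 0" by (cases m) auto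
    show False
    proof (rule powser_0_nonzero[where f = "\<lambda>_. 0" and r = "2 * pi" and a = d and \<xi> = 0 and m = m])
      show "0 < 2 * pi" by simp
      show "(\<lambda>n. d n * (x - 0) ^ n) sums 0" if "norm (x - 0) < 2 * pi" for x
        using that by (rule d')
      show "d m \<noteq> 0" "0 < m" by fact+
      fix s :: real
      assume s: "0 < s" "\<And>z::real. z \<in> cball 0 s - {0} \<Longrightarrow> (0::real) \<noteq> 0"
      have "s \<in> cball 0 s - {0}" using s(1) by (simp add: dist_norm)
      from s(2)[OF this] show False by simp
    qed simp
  qed
  then show ?thesis by (auto simp: d_def fun_eq_iff)
qed

lemma is_bernoulli_seq_bernoulli: "is_bernoulli_seq bernoulli"
proof -
  obtain B where B: "is_bernoulli_seq B" using is_bernoulli_seq_exists ..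
  show ?thesis
    unfolding bernoulli_def
    by (rule theI[of is_bernoulli_seq, OF B]) (rule is_bernoulli_seq_unique[OF _ B])
qed

end

theory Submission
  imports Defs
begin

text \<open>
  Put $N=2n+2$, let $B_k(x)$ be the Bernoulli polynomials and let $Q(t)=B_N(t/\pi)-B_N$. Odd
  Bernoulli numbers beyond $B_1$ vanish, so expanding \<open>Q\<close> in powers of \<open>t\<close> shows that the
  right-hand side of the theorem minus $(n+1)M_{2n+1}$ is
  $\pi^{2n+1}\int_0^{\pi/2}Q(t)/\sin^2 t\,dt$ (\<open>bernpoly_over_sin_sq_moments\<close>). It remains to see
  that this integral is a multiple of $\zeta(2n+1)$.

  Formally, integration by parts turns it into $\int Q'(t)\cot t\,dt$, and the divergent expansion
  $\cot t=2\sum_{k\ge1}\sin 2kt$ turns that into $\sum_k 2\int Q'(t)\sin 2kt\,dt$. This is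
  made rigorous in \<open>integral_over_sin_sq_fourier\<close> by the closed form of the partial sums of the
  cotangent expansion (\<open>cot_kernel\<close>) and the Riemann--Lebesgue lemma (\<open>Riemann_Lebesgue_cos\<close>). As
  $Q'$ is a multiple of $B_{2n+1}(t/\pi)$, repeated integration by parts evaluates the
  coefficients (\<open>bernpoly_odd_fourier\<close>):
  $2\int_0^{\pi/2} Q'(t)\sin 2kt\,dt=(-1)^{n+1}N!/(2\pi k)^{2n+1}$, and summing over \<open>k\<close> gives the
  zeta value.
\<close>

section \<open>Analytic tools\<close>

text \<open>
  For a continuously differentiable function the integral is $O(1/x)$ by one integration by
  parts; the general case follows because polynomials are uniformly dense.
\<close>

lemma Riemann_Lebesgue_cos:
  fixes f :: "real \<Rightarrow> real"
  assumes "a \<le> b" and f: "continuous_on {a..b} f"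
  shows "((\<lambda>x. integral {a..b} (\<lambda>t. f t * cos (x * t))) \<longlongrightarrow> 0) at_top"
proof (rule tendstoI)
  fix e :: real assume "e > 0"
  define d where "d = e / (2 * (b - a + 1))"
  have "d > 0" using \<open>e > 0\<close> \<open>a \<le> b\<close> by (simp add: d_def)
  obtain g where g: "real_polynomial_function g"
    and fg: "\<And>t. t \<in> {a..b} \<Longrightarrow> \<bar>f t - g t\<bar> < d"
    using Stone_Weierstrass_real_polynomial_function[OF compact_Icc f \<open>d > 0\<close>] by blast
  obtain g' where g': "real_polynomial_function g'"
    and dg: "\<And>t. (g has_real_derivative g' t) (at t)"
    using has_real_derivative_polynomial_function[OF g] by blast
  have cg: "continuous_on S g" and cg': "continuous_on S g'" for S
    using g g' continuous_on_polymonial_function real_polynomial_function_eq by blast+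
  have "bounded (g ` {a..b})" "bounded (g' ` {a..b})"
    by (auto intro!: compact_imp_bounded compact_continuous_image cg cg')
  then obtain C C' where C: "\<And>t. t \<in> {a..b} \<Longrightarrow> \<bar>g t\<bar> \<le> C" and C': "\<And>t. t \<in> {a..b} \<Longrightarrow> \<bar>g' t\<bar> \<le> C'"
    unfolding bounded_iff by fastforce
  define K where "K = 2 * C + C' * (b - a)"
  have poly: "\<bar>integral {a..b} (\<lambda>t. g t * cos (x * t))\<bar> \<le> K / x" if "x > 0" for x
  proof -
    have 1: "((\<lambda>t. g t * cos (x * t) + g' t * sin (x * t) / x) has_integral
        (g b * sin (x * b) / x - g a * sin (x * a) / x)) {a..b}"
      by (rule fundamental_theorem_of_calculus[OF \<open>a \<le> b\<close>])
         (use \<open>x > 0\<close> in \<open>auto intro!: derivative_eq_intros DERIV_subset[OF dg]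
           simp flip: has_real_derivative_iff_has_vector_derivative simp: field_simps\<close>)
    have 2: "(\<lambda>t. g' t * sin (x * t) / x) integrable_on {a..b}"
      by (intro integrable_continuous_real continuous_intros cg') (use \<open>x > 0\<close> in auto)
    have "\<bar>integral {a..b} (\<lambda>t. g' t * sin (x * t) / x)\<bar> \<le> C' / x * (b - a)"
    proof -
      have "norm (integral {a..b} (\<lambda>t. g' t * sin (x * t) / x)) \<le> C' / x * (b - a)"
      proof (rule integral_bound[OF \<open>a \<le> b\<close>])
        show "norm (g' t * sin (x * t) / x) \<le> C' / x" if "t \<in> {a..b}" for t
          using mult_mono[OF C'[OF that] abs_sin_le_one[of "x * t"]] C'[OF that] \<open>x > 0\<close>
          by (auto simp: abs_mult intro!: divide_right_mono)
      qed (intro continuous_intros cg', use \<open>x > 0\<close> in auto)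
      then show ?thesis by simp
    qed
    moreover have "\<bar>g b * sin (x * b)\<bar> \<le> C" "\<bar>g a * sin (x * a)\<bar> \<le> C"
      using mult_mono[OF C[of b] abs_sin_le_one[of "x * b"]] mult_mono[OF C[of a] abs_sin_le_one[of "x * a"]]
        C[of a] C[of b] \<open>a \<le> b\<close> by (auto simp: abs_mult)
    then have "\<bar>g b * sin (x * b) / x\<bar> \<le> C / x" "\<bar>g a * sin (x * a) / x\<bar> \<le> C / x"
      using \<open>x > 0\<close> by (auto intro!: divide_right_mono simp del: abs_mult simp: abs_divide)
    moreover have "integral {a..b} (\<lambda>t. g t * cos (x * t)) =
       (g b * sin (x * b) / x - g a * sin (x * a) / x) - integral {a..b} (\<lambda>t. g' t * sin (x * t) / x)"
      using has_integral_diff[OF 1 integrable_integral[OF 2]] by (simp add: integral_unique)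
    ultimately show ?thesis unfolding K_def add_divide_distrib times_divide_eq_left by linarith
  qed
  have diff: "\<bar>integral {a..b} (\<lambda>t. (f t - g t) * cos (x * t))\<bar> \<le> d * (b - a)" for x
  proof -
    have "norm (integral {a..b} (\<lambda>t. (f t - g t) * cos (x * t))) \<le> d * (b - a)"
    proof (rule integral_bound[OF \<open>a \<le> b\<close>])
      show "norm ((f t - g t) * cos (x * t)) \<le> d" if "t \<in> {a..b}" for t
        using mult_mono[OF less_imp_le[OF fg[OF that]] abs_cos_le_one[of "x * t"]] \<open>d > 0\<close>
        by (auto simp: abs_mult)
    qed (intro continuous_intros f cg)
    then show ?thesis by simp
  qed
  have dle: "d * (b - a) \<le> e / 2"
    using \<open>e > 0\<close> \<open>a \<le> b\<close> by (simp add: d_def field_simps)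
  have "((\<lambda>x. K / x) \<longlongrightarrow> 0) at_top"
    by (intro tendsto_divide_0[OF tendsto_const] filterlim_at_top_imp_at_infinity filterlim_ident)
  then have "\<forall>\<^sub>F x in at_top. K / x < e / 2"
    using \<open>e > 0\<close> order_tendstoD(2)[of "\<lambda>x. K / x" 0 at_top "e / 2"] by simp
  with eventually_gt_at_top[of 0]
  show "\<forall>\<^sub>F x in at_top. dist (integral {a..b} (\<lambda>t. f t * cos (x * t))) 0 < e"
  proof eventually_elim
    case (elim x)
    have "integral {a..b} (\<lambda>t. f t * cos (x * t)) =
      integral {a..b} (\<lambda>t. g t * cos (x * t)) + integral {a..b} (\<lambda>t. (f t - g t) * cos (x * t))"
      by (subst integral_add [symmetric])
         (auto intro!: integrable_continuous_real continuous_intros f cg simp: algebra_simps)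
    with poly[of x] diff[of x] dle elim show ?case
      unfolding dist_norm real_norm_def diff_0_right by linarith
  qed
qed

text \<open>
  The sines at even frequencies sum to $\cot t$ up to a term oscillating at the frequency
  $2K+1$, which the Riemann--Lebesgue lemma removes after integration. Multiplying by
  $\sin t$ makes the sum telescope.
\<close>

lemma cot_kernel:
  fixes t :: real
  assumes "sin t \<noteq> 0"
  shows "(\<Sum>k<K. 2 * sin (2 * real (Suc k) * t)) = cot t - cos (real (2 * K + 1) * t) / sin t"
proof -
  have "(\<Sum>k<K. 2 * sin (2 * real (Suc k) * t)) * sin t = cos t - cos (real (2 * K + 1) * t)"
  proof (induction K)
    case (Suc K)
    have "2 * sin (2 * real (Suc K) * t) * sin t
        = cos (2 * real (Suc K) * t - t) - cos (2 * real (Suc K) * t + t)"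
      by (simp add: cos_diff cos_add)
    also have "\<dots> = cos (real (2 * K + 1) * t) - cos (real (2 * Suc K + 1) * t)"
      by (intro arg_cong2[where f = "(-)"] arg_cong[where f = cos]) (auto simp: algebra_simps)
    finally show ?case using Suc by (simp add: distrib_right)
  qed simp
  with assms show ?thesis by (simp add: cot_def field_simps)
qed

text \<open>
  A zero of the numerator at \<open>0\<close> cancels that of the sine, so the quotients below are integrable
  and the Riemann--Lebesgue lemma applies to them. The bound \<open>b < pi\<close> excludes the next zero.
\<close>

lemma continuous_on_divide_sin:
  fixes P :: "real \<Rightarrow> real"
  assumes P: "continuous_on {0..b} P" "P 0 = 0" "(P has_real_derivative D) (at 0)" and "b < pi"
  shows "continuous_on {0..b} (\<lambda>t. if t = 0 then D else P t / sin t)"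
proof -
  have "((\<lambda>t. (P t / t) / (sin t / t)) \<longlongrightarrow> D) (at 0)"
    using P(2,3) DERIV_sin[of 0] tendsto_divide[of "\<lambda>t. P t / t" D "at 0" "\<lambda>t. sin t / t" 1]
    by (simp add: has_field_derivative_iff)
  then have lim: "((\<lambda>t. P t / sin t) \<longlongrightarrow> D) (at 0)"
    by (rule Lim_transform_eventually)
       (auto simp: eventually_at_filter simp del: divide_divide_eq_right)
  have "((\<lambda>t. if t = 0 then D else P t / sin t) \<longlongrightarrow> (if x = 0 then D else P x / sin x)) (at x within {0..b})"
    if x: "x \<in> {0..b}" for x
  proof (cases "x = 0")
    case True
    have "((\<lambda>t. if t = 0 then D else P t / sin t) \<longlongrightarrow> D) (at 0)"
      by (rule Lim_transform_eventually[OF lim]) (auto simp: eventually_at_filter)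
    then show ?thesis using True tendsto_within_subset[of _ _ 0 UNIV] by auto
  next
    case False
    with x \<open>b < pi\<close> have "sin x > 0" by (intro sin_gt_zero) auto
    then have "((\<lambda>t. P t / sin t) \<longlongrightarrow> P x / sin x) (at x within {0..b})"
      using P(1) x by (intro tendsto_intros) (auto simp: continuous_on_def)
    moreover have "\<forall>\<^sub>F t in at x within {0..b}. P t / sin t = (if t = 0 then D else P t / sin t)"
      using eventually_neq_at_within[of 0 x "{0..b}"] by eventually_elim auto
    ultimately have "((\<lambda>t. if t = 0 then D else P t / sin t) \<longlongrightarrow> P x / sin x) (at x within {0..b})"
      by (rule Lim_transform_eventually)
    then show ?thesis using False by simp
  qed
  then show ?thesis by (simp add: continuous_on_def)
qed

section \<open>Bernoulli polynomials\<close>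

definition bernpoly :: "nat \<Rightarrow> real \<Rightarrow> real" where
  "bernpoly n x = (\<Sum>k\<le>n. real (n choose k) * bernoulli (n - k) * x ^ k)"

lemma bernpoly_0: "bernpoly n 0 = bernoulli n"
  by (simp add: bernpoly_def power_0_left if_distrib sum.delta cong: if_cong)

lemma bernpoly_deriv:
  "(bernpoly (Suc n) has_real_derivative real (Suc n) * bernpoly n x) (at x)"
proof -
  have "(bernpoly (Suc n) has_real_derivative
      (\<Sum>k\<le>Suc n. real (Suc n choose k) * bernoulli (Suc n - k) * (real k * x ^ (k - 1)))) (at x)"
    unfolding bernpoly_def [abs_def] by (auto intro!: derivative_eq_intros sum.cong simp: mult_ac simp del: sum.atMost_Suc)
  also have "(\<Sum>k\<le>Suc n. real (Suc n choose k) * bernoulli (Suc n - k) * (real k * x ^ (k - 1)))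
      = (\<Sum>k\<le>n. real (Suc k * (Suc n choose Suc k)) * bernoulli (n - k) * x ^ k)"
    by (subst sum.atMost_Suc_shift) (simp add: algebra_simps del: binomial_Suc_Suc)
  also have "\<dots> = real (Suc n) * bernpoly n x"
    unfolding Suc_times_binomial by (simp add: bernpoly_def sum_distrib_left algebra_simps)
  finally show ?thesis .
qed

lemma bernpoly_scaled_deriv:
  "((\<lambda>t. bernpoly (Suc n) (t / pi)) has_real_derivative
     real (Suc n) / pi * bernpoly n (t / pi)) (at t within S)"
proof -
  have "((\<lambda>t. t / pi) has_real_derivative 1 / pi) (at t within S)"
    by (auto intro!: derivative_eq_intros)
  from DERIV_chain2[OF bernpoly_deriv this, of n] show ?thesis by simp
qed

text \<open>
  The Cauchy product of the exponential series with the Bernoulli series; the latter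
  converges absolutely at \<open>x\<close> because it converges at some \<open>r\<close> with $|x| < r < 2\pi$.
\<close>

lemma bernpoly_egf:
  assumes "x \<noteq> 0" "\<bar>x\<bar> < 2 * pi"
  shows "(\<lambda>n. bernpoly n y * (x ^ n / fact n)) sums (x * exp (x * y) / (exp x - 1))"
proof -
  have B: "(\<lambda>m. bernoulli m * (x ^ m / fact m)) sums (x / (exp x - 1))"
    using is_bernoulli_seq_bernoulli assms by (auto simp: is_bernoulli_seq_def)
  obtain r where r: "\<bar>x\<bar> < r" "r < 2 * pi" using assms(2) dense by blast
  have "(\<lambda>m. bernoulli m * (r ^ m / fact m)) sums (r / (exp r - 1))"
    using is_bernoulli_seq_bernoulli r by (auto simp: is_bernoulli_seq_def)
  then have "summable (\<lambda>m. bernoulli m / fact m * r ^ m)"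
    by (auto simp: sums_iff mult_ac)
  from powser_insidea[OF this, of x] r
  have absB: "summable (\<lambda>m. norm (bernoulli m * (x ^ m / fact m)))"
    by (simp add: mult_ac)
  have E: "(\<lambda>m. (x * y) ^ m / fact m) sums exp (x * y)"
    using exp_converges[of "x * y"] by (simp add: scaleR_conv_of_real field_simps)
  have absE: "summable (\<lambda>m. norm ((x * y) ^ m / fact m))"
    using summable_norm_exp[of "x * y"] by (simp add: field_simps)
  have "(\<lambda>n. \<Sum>i\<le>n. (x * y) ^ i / fact i * (bernoulli (n - i) * (x ^ (n - i) / fact (n - i))))
      sums (exp (x * y) * (x / (exp x - 1)))"
    using Cauchy_product_sums[OF absE absB] B E by (simp add: sums_iff)
  moreover have "(\<Sum>i\<le>n. (x * y) ^ i / fact i * (bernoulli (n - i) * (x ^ (n - i) / fact (n - i))))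
      = bernpoly n y * (x ^ n / fact n)" for n
    unfolding bernpoly_def sum_distrib_right
  proof (rule sum.cong)
    fix i assume "i \<in> {..n}"
    then have "x ^ n = x ^ i * x ^ (n - i)" and "real (n choose i) = fact n / (fact i * fact (n - i))"
      by (simp_all add: binomial_fact flip: power_add)
    then show "(x * y) ^ i / fact i * (bernoulli (n - i) * (x ^ (n - i) / fact (n - i)))
        = real (n choose i) * bernoulli (n - i) * y ^ i * (x ^ n / fact n)"
      by (simp add: power_mult_distrib)
  qed simp
  ultimately show ?thesis by (simp add: mult_ac)
qed

text \<open>
  Coefficient comparison is inherited from the uniqueness of the Bernoulli numbers: a
  sequence with generating function zero may be added to them.
\<close>

lemma egf_zero_imp_zero:
  assumes "\<And>x::real. x \<noteq> 0 \<Longrightarrow> \<bar>x\<bar> < 2 * pi \<Longrightarrow> (\<lambda>m. d m * (x ^ m / fact m)) sums 0"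
  shows "d m = 0"
proof -
  have "(\<lambda>m. (bernoulli m + d m) * (x ^ m / fact m)) sums (x / (exp x - 1))"
    if "x \<noteq> 0" "\<bar>x\<bar> < 2 * pi" for x
    using sums_add[OF is_bernoulli_seq_bernoulli[unfolded is_bernoulli_seq_def, rule_format, OF conjI[OF that]] assms[OF that]]
    by (simp only: distrib_right add_0_right)
  then have "is_bernoulli_seq (\<lambda>m. bernoulli m + d m)" by (simp add: is_bernoulli_seq_def)
  from fun_cong[OF is_bernoulli_seq_unique[OF this is_bernoulli_seq_bernoulli], of m]
  show ?thesis by simp
qed

text \<open>
  Replacing $(x,y)$ by $(-x,1-y)$ leaves the generating function $xe^{xy}/(e^x-1)$ unchanged.
\<close>

lemma bernpoly_reflect: "bernpoly n (1 - y) = (-1) ^ n * bernpoly n y"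
proof -
  have "bernpoly n (1 - y) - (-1) ^ n * bernpoly n y = 0"
  proof (rule egf_zero_imp_zero[where d = "\<lambda>n. bernpoly n (1 - y) - (-1) ^ n * bernpoly n y"])
    fix x :: real assume x: "x \<noteq> 0" "\<bar>x\<bar> < 2 * pi"
    have "(\<lambda>n. bernpoly n (1 - y) * (x ^ n / fact n) - bernpoly n y * ((- x) ^ n / fact n)) sums
        (x * exp (x * (1 - y)) / (exp x - 1) - - x * exp (- x * y) / (exp (- x) - 1))"
      using x by (intro sums_diff bernpoly_egf) auto
    moreover have "x * exp (x * (1 - y)) / (exp x - 1) = - x * exp (- x * y) / (exp (- x) - 1)"
    proof -
      have eq: "x * (E / W) / (E - 1) = - x * (1 / W) / (1 / E - 1)" if "E \<noteq> 0" "E \<noteq> 1" "W \<noteq> 0" for E W :: real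
        using that by (simp add: field_simps)
      have "exp (x * (1 - y)) = exp x / exp (x * y)"
        by (simp add: right_diff_distrib exp_diff)
      moreover have "exp (- x * y) = 1 / exp (x * y)" "exp (- x) = 1 / exp x"
        by (simp_all add: exp_minus inverse_eq_divide)
      ultimately show ?thesis using eq[of "exp x" "exp (x * y)"] x by simp
    qed
    ultimately show "(\<lambda>n. (bernpoly n (1 - y) - (-1) ^ n * bernpoly n y) * (x ^ n / fact n)) sums 0"
      by (simp add: power_minus[of x] algebra_simps)
  qed
  then show ?thesis by simp
qed

text \<open>
  The generating functions at $y=1$ and $y=0$ differ by exactly $x$. Together with the
  reflection formula this determines
  $B_0$, $B_1$ and the odd Bernoulli numbers.
\<close>

lemma bernpoly_1_minus_0: "bernpoly n 1 - bernoulli n = (if n = 1 then 1 else 0)"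
proof -
  have "bernpoly n 1 - bernoulli n - (if n = 1 then 1 else 0) = 0"
  proof (rule egf_zero_imp_zero[where d = "\<lambda>n. bernpoly n 1 - bernoulli n - (if n = 1 then 1 else 0)"])
    fix x :: real assume x: "x \<noteq> 0" "\<bar>x\<bar> < 2 * pi"
    have "(\<lambda>n. if n = 1 then x ^ n / fact n else 0) sums (x ^ 1 / fact 1)" by (rule sums_single)
    then have "(\<lambda>n. bernpoly n 1 * (x ^ n / fact n) - bernpoly n 0 * (x ^ n / fact n)
          - (if n = 1 then x ^ n / fact n else 0)) sums
        (x * exp (x * 1) / (exp x - 1) - x * exp (x * 0) / (exp x - 1) - x ^ 1 / fact 1)"
      using x by (intro sums_diff bernpoly_egf) auto
    moreover have "x * exp (x * 1) / (exp x - 1) - x * exp (x * 0) / (exp x - 1) - x ^ 1 / fact 1 = 0"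
      using x by (simp add: divide_simps) (simp add: algebra_simps)
    moreover have "bernpoly n 1 * (x ^ n / fact n) - bernpoly n 0 * (x ^ n / fact n)
          - (if n = 1 then x ^ n / fact n else 0)
        = (bernpoly n 1 - bernoulli n - (if n = 1 then 1 else 0)) * (x ^ n / fact n)" for n
      by (simp add: bernpoly_0 algebra_simps)
    ultimately show "(\<lambda>n. (bernpoly n 1 - bernoulli n - (if n = 1 then 1 else 0)) * (x ^ n / fact n)) sums 0"
      by (simp only:)
  qed
  then show ?thesis by simp
qed

lemma bernoulli_0: "bernoulli 0 = 1"
  using bernpoly_1_minus_0[of 1] by (simp add: bernpoly_def)

lemma bernoulli_1: "bernoulli 1 = - 1 / 2"
  using bernpoly_1_minus_0[of 1] bernpoly_reflect[of 1 0] by (simp add: bernpoly_0)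

lemma bernoulli_odd: "odd n \<Longrightarrow> n \<noteq> 1 \<Longrightarrow> bernoulli n = 0"
  using bernpoly_1_minus_0[of n] bernpoly_reflect[of n 0] by (simp add: bernpoly_0)

lemma bernpoly_odd_half: "odd n \<Longrightarrow> bernpoly n (1 / 2) = 0"
  using bernpoly_reflect[of n "1 / 2"] by simp

section \<open>Sine coefficients of the odd Bernoulli polynomials\<close>

text \<open>
  Two integrations by parts lower the degree by two and cost a factor
  $-(2m+3)(2m+2)/(2\pi k)^2$. The boundary terms vanish although the interval is only half a
  period of the Bernoulli polynomial: those with a sine because \<open>k\<close> is an integer, those with a
  cosine because Bernoulli polynomials of odd degree at least 3 vanish at both $0$ and $1/2$.
\<close>

lemma bernpoly_odd_fourier:
  assumes "k > 0"
  shows "((\<lambda>t. bernpoly (2 * m + 1) (t / pi) * sin (2 * real k * t)) has_integral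
    ((-1) ^ (m + 1) * pi * fact (2 * m + 1) / (2 * (2 * pi * real k) ^ (2 * m + 1)))) {0..pi/2}"
proof (induction m)
  case 0
  have b1: "bernpoly (Suc 0) x = x - 1 / 2" for x
    using bernoulli_0 bernoulli_1 by (simp add: bernpoly_def)
  have "((\<lambda>t. bernpoly 1 (t / pi) * sin (2 * real k * t)) has_integral
     ((\<lambda>t. - (t / pi - 1 / 2) * cos (2 * real k * t) / (2 * k) + sin (2 * real k * t) / (4 * pi * k\<^sup>2)) (pi / 2)
     - (\<lambda>t. - (t / pi - 1 / 2) * cos (2 * real k * t) / (2 * k) + sin (2 * real k * t) / (4 * pi * k\<^sup>2)) 0)) {0..pi/2}"
    by (rule fundamental_theorem_of_calculus)
       (use assms in \<open>auto intro!: derivative_eq_intros simp: b1 field_simps power2_eq_square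
           simp flip: has_real_derivative_iff_has_vector_derivative\<close>)
  then show ?case using assms sin_npi[of k] by (simp add: mult.commute field_simps)
next
  case (Suc m)
  define q u v where "q = real k" and "u = real (2 * m + 3)" and "v = real (2 * m + 2)"
  have "q > 0" using assms by (simp add: q_def)
  define c where "c = u * v / (2 * pi * q)\<^sup>2"
  \<comment> \<open>Both integrations by parts at once: the cosine terms cancel in the derivative of \<open>A\<close>.\<close>
  define A where "A t = - (bernpoly (2 * m + 3) (t / pi) * cos (2 * q * t) / (2 * q))
      + u / pi * bernpoly (2 * m + 2) (t / pi) * sin (2 * q * t) / (4 * q\<^sup>2)" for t
  have d3: "((\<lambda>t. bernpoly (2 * m + 3) (t / pi)) has_real_derivative
      u / pi * bernpoly (2 * m + 2) (t / pi)) (at t within S)" for t S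
    using bernpoly_scaled_deriv[of "2 * m + 2" t S] by (simp add: numeral_3_eq_3 u_def)
  have d2: "((\<lambda>t. bernpoly (2 * m + 2) (t / pi)) has_real_derivative
      v / pi * bernpoly (2 * m + 1) (t / pi)) (at t within S)" for t S
    using bernpoly_scaled_deriv[of "2 * m + 1" t S] by (simp add: v_def)
  have dC: "((\<lambda>t. cos (2 * q * t)) has_real_derivative - (2 * q * sin (2 * q * t))) (at t within S)"
    and dS: "((\<lambda>t. sin (2 * q * t)) has_real_derivative 2 * q * cos (2 * q * t)) (at t within S)" for t S
    by (auto intro!: derivative_eq_intros)
  have "(A has_real_derivative bernpoly (2 * m + 3) (t / pi) * sin (2 * q * t)
       + c * (bernpoly (2 * m + 1) (t / pi) * sin (2 * q * t))) (at t within S)" for t S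
    unfolding A_def
    by (rule DERIV_cong, (rule DERIV_add DERIV_minus d3 d2 dC dS DERIV_cdivide DERIV_cmult DERIV_mult)+)
       (use \<open>q > 0\<close> in \<open>simp add: c_def power2_eq_square divide_simps\<close>,
        simp add: algebra_simps)
  then have "((\<lambda>t. bernpoly (2 * m + 3) (t / pi) * sin (2 * real k * t)
       + c * (bernpoly (2 * m + 1) (t / pi) * sin (2 * real k * t))) has_integral (A (pi / 2) - A 0)) {0..pi/2}"
    by (intro fundamental_theorem_of_calculus)
       (simp_all add: q_def flip: has_real_derivative_iff_has_vector_derivative)
  from has_integral_diff[OF this has_integral_mult_right[OF Suc.IH, of c]]
  have "((\<lambda>t. bernpoly (2 * m + 3) (t / pi) * sin (2 * real k * t)) has_integral
     (A (pi / 2) - A 0 - c * ((-1) ^ (m + 1) * pi * fact (2 * m + 1) / (2 * (2 * pi * real k) ^ (2 * m + 1))))) {0..pi/2}"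
    by simp
  moreover have "A (pi / 2) = 0" "A 0 = 0"
    using bernpoly_odd_half[of "2 * m + 3"] bernoulli_odd[of "2 * m + 3"] sin_npi[of k]
    by (simp_all add: A_def bernpoly_0 q_def mult.commute)
  moreover have "- (c * ((-1) ^ (m + 1) * pi * fact (2 * m + 1) / (2 * (2 * pi * real k) ^ (2 * m + 1))))
      = (-1) ^ (Suc m + 1) * pi * fact (2 * m + 3) / (2 * (2 * pi * real k) ^ (2 * m + 3))"
  proof -
    have f: "fact (2 * m + 3) = u * v * fact (2 * m + 1)"
      by (simp add: numeral_3_eq_3 u_def v_def algebra_simps)
    have p: "(2 * pi * q) ^ (2 * m + 3) = (2 * pi * q)\<^sup>2 * (2 * pi * q) ^ (2 * m + 1)"
      by (simp add: power2_eq_square numeral_3_eq_3)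
    show ?thesis unfolding f c_def q_def [symmetric] p by (simp add: mult_ac)
  qed
  moreover have "2 * Suc m + 1 = 2 * m + 3" by simp
  ultimately show ?case by (simp only: diff_0_right diff_0)
qed

section \<open>Integrals against the inverse square of the sine\<close>

lemma integrable_power_over_sin_sq:
  assumes "m \<ge> 2"
  shows "(\<lambda>t::real. t ^ m / (sin t)\<^sup>2) integrable_on {0..pi/2}"
proof -
  define h where "h t = (if t = 0 then 1 else t / sin t)" for t :: real
  have h: "continuous_on {0..pi/2} h"
    unfolding h_def by (rule continuous_on_divide_sin) (auto intro!: continuous_intros derivative_eq_intros)
  show ?thesis
  proof (rule integrable_spike[where S = "{0}"])
    show "(\<lambda>t. t ^ (m - 2) * (h t)\<^sup>2) integrable_on {0..pi/2}"
      by (intro integrable_continuous_real continuous_intros h)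
    show "t ^ m / (sin t)\<^sup>2 = t ^ (m - 2) * (h t)\<^sup>2" if "t \<in> {0..pi/2} - {0}" for t
      proof -
      have "t ^ m = t ^ (m - 2) * t\<^sup>2" using power_add[of t "m - 2" 2] assms by (simp only: le_add_diff_inverse2)
      then show ?thesis using that by (simp add: h_def power_divide)
    qed
  qed simp
qed

text \<open>
  Since $-\cot$ is a primitive of $1/\sin^2$, and $Q\cot$ vanishes at both ends (at $0$ because
  \<open>Q\<close> has a double zero there), \<open>I\<close> equals $\int P\cot t\,dt$. Expanding the cotangent by
  \<open>cot_kernel\<close> leaves the error $\int (P/\sin t)\cos((2K+1)t)\,dt$, where $P/\sin t$ is continuous
  because $P(0)=0$, so that the Riemann--Lebesgue lemma applies.
\<close>

lemma integral_over_sin_sq_fourier: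
  fixes P Q R :: "real \<Rightarrow> real"
  assumes Q: "\<And>t. (Q has_real_derivative P t) (at t)" "Q 0 = 0"
    and P: "\<And>t. (P has_real_derivative R t) (at t)" "P 0 = 0"
    and I: "((\<lambda>t. Q t / (sin t)\<^sup>2) has_integral I) {0..pi/2}"
  shows "(\<lambda>k. 2 * integral {0..pi/2} (\<lambda>t. P t * sin (2 * real (Suc k) * t))) sums I"
proof -
  have contQ: "continuous_on S Q" and contP: "continuous_on S P" for S
    using Q(1) P(1) by (meson DERIV_continuous continuous_at_imp_continuous_on)+
  define G where "G t = (if t = 0 then R 0 else P t / sin t)" for t
  have G: "continuous_on {0..pi/2} G"
    unfolding G_def by (rule continuous_on_divide_sin) (use P contP in auto)
  \<comment> \<open>As \<open>P 0 = 0\<close>, the continuous extension has at \<open>0\<close> the default value of \<open>Q 0 / sin 0\<close>.\<close>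
  have "continuous_on {0..pi/2} (\<lambda>t. if t = 0 then P 0 else Q t / sin t)"
    by (rule continuous_on_divide_sin) (use Q contQ in auto)
  then have F: "continuous_on {0..pi/2} (\<lambda>t. Q t / sin t)"
    by (rule continuous_on_eq) (use P(2) in auto)
  have "((\<lambda>t. G t * cos t - Q t / (sin t)\<^sup>2) has_integral
      (Q (pi / 2) / sin (pi / 2) * cos (pi / 2) - Q 0 / sin 0 * cos 0)) {0..pi/2}"
  proof (rule fundamental_theorem_of_calculus_interior)
    show "continuous_on {0..pi/2} (\<lambda>t. Q t / sin t * cos t)"
      by (intro continuous_intros F)
    fix t assume t: "t \<in> {0<..<pi/2}"
    then have pos: "sin t > 0" by (intro sin_gt_zero) auto
    have eq: "(P t * sin t - Q t * cos t) / (sin t * sin t) * cos t + - sin t * (Q t / sin t)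
        = G t * cos t - Q t / (sin t)\<^sup>2"
    proof -
      have "(p * s - r * c) / (s * s) * c + - s * (r / s) = p / s * c - r * (s\<^sup>2 + c\<^sup>2) / s\<^sup>2"
        if "s \<noteq> 0" for p r s c :: real
        using that by (simp add: field_simps power2_eq_square)
      from this[of "sin t" "P t" "Q t" "cos t"] show ?thesis using pos t by (simp add: G_def)
    qed
    show "((\<lambda>t. Q t / sin t * cos t) has_vector_derivative G t * cos t - Q t / (sin t)\<^sup>2) (at t)"
      unfolding has_real_derivative_iff_has_vector_derivative [symmetric] eq [symmetric]
      by (intro DERIV_mult DERIV_divide Q DERIV_sin DERIV_cos) (use pos in simp)
  qed simp
  from has_integral_add[OF this I] have Gcos: "((\<lambda>t. G t * cos t) has_integral I) {0..pi/2}"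
    using Q(2) by simp
  have partial: "(\<Sum>k<K. 2 * integral {0..pi/2} (\<lambda>t. P t * sin (2 * real (Suc k) * t)))
      = I - integral {0..pi/2} (\<lambda>t. G t * cos (real (2 * K + 1) * t))" for K
  proof -
    have "(\<Sum>k<K. 2 * integral {0..pi/2} (\<lambda>t. P t * sin (2 * real (Suc k) * t)))
        = integral {0..pi/2} (\<lambda>t. \<Sum>k<K. 2 * (P t * sin (2 * real (Suc k) * t)))"
      by (subst integral_sum) (auto intro!: integrable_continuous_real continuous_intros contP)
    also have "\<dots> = integral {0..pi/2} (\<lambda>t. G t * cos t - G t * cos (real (2 * K + 1) * t))"
    proof (rule integral_cong)
      fix t assume t: "t \<in> {0..pi/2}"
      show "(\<Sum>k<K. 2 * (P t * sin (2 * real (Suc k) * t))) = G t * cos t - G t * cos (real (2 * K + 1) * t)"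
      proof (cases "t = 0")
        case False
        with t have "sin t > 0" by (intro sin_gt_zero) auto
        then have "P t * (\<Sum>k<K. 2 * sin (2 * real (Suc k) * t)) = P t * (cot t - cos (real (2 * K + 1) * t) / sin t)"
          by (subst cot_kernel) auto
        then show ?thesis
          using False by (simp add: G_def cot_def sum_distrib_left algebra_simps)
        \<comment> \<open>At \<open>t = 0\<close> every sine vanishes, and so does \<open>G 0 - G 0\<close>.\<close>
      qed simp
    qed
    also have "\<dots> = I - integral {0..pi/2} (\<lambda>t. G t * cos (real (2 * K + 1) * t))"
      by (subst integral_diff)
         (auto intro!: integrable_continuous_real continuous_intros G simp: integral_unique[OF Gcos])
    finally show ?thesis .
  qed
  have "filterlim (\<lambda>K. real (2 * K + 1)) at_top sequentially"
    by (rule filterlim_compose[OF filterlim_real_sequentially])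
       (auto intro!: filterlim_subseq simp: strict_mono_def)
  then have "(\<lambda>K. integral {0..pi/2} (\<lambda>t. G t * cos (real (2 * K + 1) * t))) \<longlonglongrightarrow> 0"
    by (rule filterlim_compose[OF Riemann_Lebesgue_cos[OF _ G], rotated]) simp
  from tendsto_diff[OF tendsto_const this, of I] show ?thesis
    unfolding sums_def partial by simp
qed

text \<open>
  Dividing the Bernoulli polynomial of even degree \<open>N\<close> termwise by $\sin^2$: its constant term
  is subtracted, and among the odd powers only $t^{N-1}$ survives, with coefficient governed by
  $B_1=-1/2$. That term is the origin of the separate moment \<open>M (2 * n + 1)\<close> in the theorem.
\<close>

lemma bernpoly_over_sin_sq_moments:
  assumes "n \<ge> 1"
  defines "N \<equiv> 2 * n + 2"
  shows "((\<lambda>t. (bernpoly N (t / pi) - bernoulli N) / (sin t)\<^sup>2) has_integral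
     (\<Sum>m=0..n. real (N choose (2 * m + 2)) * bernoulli (2 * (n - m)) / pi ^ (2 * m + 2) * M (2 * m + 2))
       - real (n + 1) / pi ^ (2 * n + 1) * M (2 * n + 1)) {0..pi/2}"
proof -
  define c where "c k = real (N choose k) * bernoulli (N - k) / pi ^ k" for k
  have split: "(\<Sum>k=2..2*p+2. f k) = (\<Sum>m=0..p. f (2 * m + 2)) + (\<Sum>m=1..p. f (2 * m + 1))"
    for f :: "nat \<Rightarrow> real" and p
    by (induction p) (simp_all add: algebra_simps)
  have "c 1 = 0"
    using bernoulli_odd[of "2 * n + 1"] assms(1) by (simp add: c_def N_def)
  have Q: "bernpoly N (t / pi) - bernoulli N = (\<Sum>k=2..N. c k * t ^ k)" for t
  proof -
    have "{..N} = insert 0 (insert 1 {2..N})" by (auto simp: N_def)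
    then have "bernpoly N (t / pi) = bernoulli N + c 1 * t + (\<Sum>k=2..N. c k * t ^ k)"
      by (simp add: bernpoly_def c_def power_divide)
    with \<open>c 1 = 0\<close> show ?thesis by simp
  qed
  have "((\<lambda>t. \<Sum>k=2..N. c k * (t ^ k / (sin t)\<^sup>2)) has_integral (\<Sum>k=2..N. c k * M k)) {0..pi/2}"
    unfolding M_def
    by (intro has_integral_sum has_integral_mult_right integrable_integral integrable_power_over_sin_sq) auto
  then have "((\<lambda>t. (bernpoly N (t / pi) - bernoulli N) / (sin t)\<^sup>2) has_integral (\<Sum>k=2..N. c k * M k)) {0..pi/2}"
    by (simp add: Q sum_divide_distrib)
  moreover have "(\<Sum>k=2..N. c k * M k) =
      (\<Sum>m=0..n. c (2 * m + 2) * M (2 * m + 2)) + (\<Sum>m=1..n. c (2 * m + 1) * M (2 * m + 1))"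
    unfolding N_def by (rule split)
  moreover have "(\<Sum>m=1..n. c (2 * m + 1) * M (2 * m + 1)) = c (2 * n + 1) * M (2 * n + 1)"
  proof -
    have "(\<Sum>m=1..n. c (2 * m + 1) * M (2 * m + 1)) = (\<Sum>m\<in>{n}. c (2 * m + 1) * M (2 * m + 1))"
    proof (rule sum.mono_neutral_right)
      show "\<forall>m\<in>{1..n} - {n}. c (2 * m + 1) * M (2 * m + 1) = 0"
      proof
        fix m assume "m \<in> {1..n} - {n}"
        then have "odd (N - (2 * m + 1))" "N - (2 * m + 1) \<noteq> 1" by (auto simp: N_def)
        then show "c (2 * m + 1) * M (2 * m + 1) = 0" by (simp add: c_def bernoulli_odd)
      qed
    qed (use assms(1) in auto)
    then show ?thesis by simp
  qed
  moreover have "c (2 * n + 1) = - (real (n + 1) / pi ^ (2 * n + 1))"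
  proof -
    have "N choose (2 * n + 1) = N" "N - (2 * n + 1) = 1"
      using binomial_symmetric[of "2 * n + 1" N] by (simp_all add: N_def)
    then show ?thesis using bernoulli_1 by (simp add: c_def N_def field_simps)
  qed
  moreover have "c (2 * m + 2) = real (N choose (2 * m + 2)) * bernoulli (2 * (n - m)) / pi ^ (2 * m + 2)" for m
    by (simp add: c_def N_def diff_mult_distrib2)
  ultimately show ?thesis by simp
qed

section \<open>The zeta value\<close>

theorem mainTheorem14:
  fixes n :: nat
  assumes "n \<ge> 1"
  shows "(-1) ^ (n + 1) * fact (2 * (n + 1)) * 2 powi (- 2 * int n - 1) * zeta (real (2 * n + 1))
           + real (n + 1) * M (2 * n + 1)
         = (\<Sum>m=0..n. real ((2 * (n + 1)) choose (2 * (m + 1))) * bernoulli (2 * (n - m))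
              * pi powi (2 * (int n - int m) - 1) * M (2 * (m + 1)))"
proof -
  define N where "N = 2 * n + 2"
  define I where "I = (\<Sum>m=0..n. real (N choose (2 * m + 2)) * bernoulli (2 * (n - m)) / pi ^ (2 * m + 2) * M (2 * m + 2))
       - real (n + 1) / pi ^ (2 * n + 1) * M (2 * n + 1)"
  define a where "a = (-1) ^ (n + 1) * fact N / (2 * pi) ^ (2 * n + 1)"
  define P where "P t = real N / pi * bernpoly (2 * n + 1) (t / pi)" for t
  have "(\<lambda>k. 2 * integral {0..pi/2} (\<lambda>t. P t * sin (2 * real (Suc k) * t))) sums I"
  proof (rule integral_over_sin_sq_fourier)
    show "((\<lambda>t. bernpoly N (t / pi) - bernoulli N) has_real_derivative P t) (at t)" for t
      using DERIV_diff[OF bernpoly_scaled_deriv[of "2 * n + 1" t UNIV] DERIV_const]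
      by (simp add: N_def P_def)
    show "(P has_real_derivative real N / pi * (real (2 * n + 1) / pi * bernpoly (2 * n) (t / pi))) (at t)" for t
      unfolding P_def [abs_def] using DERIV_cmult[OF bernpoly_scaled_deriv[of "2 * n" t UNIV], of "real N / pi"]
      by simp
    show "P 0 = 0"
      using bernoulli_odd[of "2 * n + 1"] assms by (simp add: P_def bernpoly_0)
    show "((\<lambda>t. (bernpoly N (t / pi) - bernoulli N) / (sin t)\<^sup>2) has_integral I) {0..pi/2}"
      unfolding I_def N_def by (rule bernpoly_over_sin_sq_moments[OF assms])
  qed (simp add: bernpoly_0)
  moreover have "2 * integral {0..pi/2} (\<lambda>t. P t * sin (2 * real (Suc k) * t))
      = a * (1 / real (Suc k) powr real (2 * n + 1))" for k
  proof -
    define q where "q = real (Suc k)"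
    have "q > 0" by (simp add: q_def)
    have "((\<lambda>t. real N / pi * (bernpoly (2 * n + 1) (t / pi) * sin (2 * q * t))) has_integral
      (real N / pi * ((-1) ^ (n + 1) * pi * fact (2 * n + 1) / (2 * (2 * pi * q) ^ (2 * n + 1))))) {0..pi/2}"
      unfolding q_def by (intro has_integral_mult_right bernpoly_odd_fourier) simp
    then have "2 * integral {0..pi/2} (\<lambda>t. P t * sin (2 * q * t))
       = 2 * (real N / pi * ((-1) ^ (n + 1) * pi * fact (2 * n + 1) / (2 * (2 * pi * q) ^ (2 * n + 1))))"
      unfolding P_def mult.assoc by (simp only: integral_unique)
    also have "\<dots> = (-1) ^ (n + 1) * (real N * fact (2 * n + 1)) / ((2 * pi) ^ (2 * n + 1) * q ^ (2 * n + 1))"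
      unfolding power_mult_distrib[of "2 * pi" q] by (simp add: power_mult_distrib mult_ac)
    also have "real N * fact (2 * n + 1) = fact N"
      by (simp add: N_def)
    also have "q ^ (2 * n + 1) = q powr real (2 * n + 1)"
      using \<open>q > 0\<close> by (simp only: powr_realpow)
    finally show ?thesis by (simp add: a_def q_def)
  qed
  ultimately have "(\<lambda>k. a * (1 / real (Suc k) powr real (2 * n + 1))) sums I" by simp
  moreover have "a \<noteq> 0" by (simp add: a_def)
  ultimately have "(\<lambda>k. 1 / real (Suc k) powr real (2 * n + 1)) sums (I / a)"
    by (rule sums_mult_D)
  then have "zeta (real (2 * n + 1)) = I / a"
    unfolding zeta_def by (rule sums_unique [symmetric])
  with \<open>a \<noteq> 0\<close> have I_zeta: "a * zeta (real (2 * n + 1)) = I" by simp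
  have two: "2 powi (- 2 * int n - 1) = (1 / 2 ^ (2 * n + 1) :: real)"
  proof -
    have "- 2 * int n - 1 = - int (2 * n + 1)" by simp
    then show ?thesis by (simp only: power_int_minus power_int_of_nat inverse_eq_divide)
  qed
  have pi: "pi powi (2 * (int n - int m) - 1) = pi ^ (2 * n + 1) / pi ^ (2 * m + 2)" for m
  proof -
    have "2 * (int n - int m) - 1 = int (2 * n + 1) - int (2 * m + 2)" by simp
    then show ?thesis by (simp only: power_int_diff[OF disjI1[OF pi_neq_zero]] power_int_of_nat)
  qed
  have "(-1) ^ (n + 1) * fact (2 * (n + 1)) * 2 powi (- 2 * int n - 1) * zeta (real (2 * n + 1))
      = pi ^ (2 * n + 1) * (a * zeta (real (2 * n + 1)))"
    unfolding two a_def N_def power_mult_distrib[of 2 pi] by simp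
  also have "\<dots> = pi ^ (2 * n + 1) * I" by (simp only: I_zeta)
  also have "\<dots> = (\<Sum>m=0..n. pi ^ (2 * n + 1) * (real (N choose (2 * m + 2)) * bernoulli (2 * (n - m)) / pi ^ (2 * m + 2) * M (2 * m + 2)))
       - real (n + 1) * M (2 * n + 1)"
    unfolding I_def right_diff_distrib sum_distrib_left by simp
  also have "(\<Sum>m=0..n. pi ^ (2 * n + 1) * (real (N choose (2 * m + 2)) * bernoulli (2 * (n - m)) / pi ^ (2 * m + 2) * M (2 * m + 2)))
      = (\<Sum>m=0..n. real ((2 * (n + 1)) choose (2 * (m + 1))) * bernoulli (2 * (n - m))
              * pi powi (2 * (int n - int m) - 1) * M (2 * (m + 1)))"
    unfolding pi N_def by (intro sum.cong) simp_all
  finally show ?thesis by simp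
qed

end
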